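(* Let $Q_1$ and $Q_2$ be probability measures on $\mathbb{R}$, equipped with its Borel $\sigma$-field $\mathcal{B}$. The following four conditions are equivalent: (i) There exist a $\sigma$-finite measure $\mu$ on $(\mathbb{R},\mathcal{B})$ and densities $g_j = \mathrm{d}Q_j/\mathrm{d}\mu$ ($j=1,2$) such that $g_2/g_1$ is isotonic on $\{g_1+g_2>0\}$. (ii) There exist a $\sigma$-finite measure $\mu$ on $(\mathbb{R},\mathcal{B})$ and densities $g_j = \mathrm{d}Q_j/\mathrm{d}\mu$ ($j=1,2$) such that $g_1(y)g_2(x) \le g_1(x)g_2(y)$ whenever $x<y$. (iii) For arbitrary sets $A,B\in\mathcal{B}$ such that $A<B$ (element-wise), $Q_1(B)Q_2(A) \le Q_1(A)Q_2(B)$. (iv) There exists a dense subset $D$ of $\mathbb{R}$ such that for all intervals $A=(x,y]$ and $B=(y,z]$ with endpoints $x<y<z$ in $D$, $Q_1(B)Q_2(A)\le Q_1(A)Q_2(B)$.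
   Context: Densities are understood as measurable functions $\mathbb{R}\to[0,\infty)$. The ratio $g_2/g_1$ on $\{g_1+g_2>0\}$ takes values in $[0,\infty]$, with $c/0:=\infty$ for $c>0$. "Isotonic" means non-decreasing. For sets $A,B\subset\mathbb{R}$, $A<B$ element-wise means $a<b$ for all $a\in A$, $b\in B$. *)

theory Defs
  imports "HOL-Probability.Probability"
begin

text \<open>
  Densities are everywhere finite and nonnegative, hence real-valued. The equation
  \<open>Q = density \<mu> g\<close> also forces \<open>sets Q = sets \<mu>\<close>.
\<close>

definition is_density :: "real measure \<Rightarrow> real measure \<Rightarrow> (real \<Rightarrow> real) \<Rightarrow> bool" where
  "is_density Q \<mu> g \<longleftrightarrow>
     g \<in> borel_measurable borel \<and> (\<forall>x. 0 \<le> g x) \<and> Q = density \<mu> (\<lambda>x. ennreal (g x))"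

definition sigma_finite_borel :: "real measure \<Rightarrow> bool" where
  "sigma_finite_borel \<mu> \<longleftrightarrow> sets \<mu> = sets borel \<and> sigma_finite_measure \<mu>"

text \<open>
  The ratio is taken in \<^typ>\<open>ennreal\<close>, where \<open>c / 0 = \<infinity>\<close> for \<open>c > 0\<close>;
  the value of \<open>0 / 0\<close> is irrelevant, since the domain excludes it.
\<close>

lemma ratio_zero: "ennreal c / ennreal 0 = \<infinity>" if "c > 0"
  using that by (simp add: divide_ennreal_def ennreal_mult_top)

lemma ratio_pos: "ennreal c / ennreal d = ennreal (c / d)" if "c \<ge> 0" "d > 0"
  using that by (rule divide_ennreal)

definition isotonic_density_ratio :: "real measure \<Rightarrow> real measure \<Rightarrow> bool" where
  "isotonic_density_ratio Q\<^sub>1 Q\<^sub>2 \<longleftrightarrow>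
     (\<exists>\<mu> g\<^sub>1 g\<^sub>2. sigma_finite_borel \<mu> \<and> is_density Q\<^sub>1 \<mu> g\<^sub>1 \<and> is_density Q\<^sub>2 \<mu> g\<^sub>2 \<and>
        mono_on {x. g\<^sub>1 x + g\<^sub>2 x > 0} (\<lambda>x. ennreal (g\<^sub>2 x) / ennreal (g\<^sub>1 x)))"

definition density_cross_ineq :: "real measure \<Rightarrow> real measure \<Rightarrow> bool" where
  "density_cross_ineq Q\<^sub>1 Q\<^sub>2 \<longleftrightarrow>
     (\<exists>\<mu> g\<^sub>1 g\<^sub>2. sigma_finite_borel \<mu> \<and> is_density Q\<^sub>1 \<mu> g\<^sub>1 \<and> is_density Q\<^sub>2 \<mu> g\<^sub>2 \<and>
        (\<forall>x y. x < y \<longrightarrow> g\<^sub>1 y * g\<^sub>2 x \<le> g\<^sub>1 x * g\<^sub>2 y))"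

definition borel_cross_ineq :: "real measure \<Rightarrow> real measure \<Rightarrow> bool" where
  "borel_cross_ineq Q\<^sub>1 Q\<^sub>2 \<longleftrightarrow>
     (\<forall>A\<in>sets borel. \<forall>B\<in>sets borel. (\<forall>a\<in>A. \<forall>b\<in>B. a < b) \<longrightarrow>
        measure Q\<^sub>1 B * measure Q\<^sub>2 A \<le> measure Q\<^sub>1 A * measure Q\<^sub>2 B)"

definition interval_cross_ineq :: "real measure \<Rightarrow> real measure \<Rightarrow> bool" where
  "interval_cross_ineq Q\<^sub>1 Q\<^sub>2 \<longleftrightarrow>
     (\<exists>D. closure D = UNIV \<and>
        (\<forall>x\<in>D. \<forall>y\<in>D. \<forall>z\<in>D. x < y \<and> y < z \<longrightarrow>
           measure Q\<^sub>1 {y<..z} * measure Q\<^sub>2 {x<..y} \<le> measure Q\<^sub>1 {x<..y} * measure Q\<^sub>2 {y<..z}))"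

end

theory Submission
  imports Defs
begin

text \<open>
  The implication from intervals to densities avoids differentiation of measures. For each
  rational \<open>q\<close>, the cross inequality yields a slope \<open>s \<in> [0, 1]\<close> with
  \<open>(1 - s) Q\<^sub>2 \<le> s Q\<^sub>1\<close> on the intervals to the left of \<open>q\<close> and the reverse on those to the
  right. Since \<open>G - F\<close> is a distribution function if \<open>F, G\<close> are those of two measures with
  \<open>M \<le> N\<close> on intervals, such inequalities extend to all Borel sets and hence to the densities
  almost everywhere. If \<open>x < q < y\<close> lie outside the countable union of the exceptional sets,
  multiplying the inequality at \<open>x\<close> by the one at \<open>y\<close> gives
  \<open>g\<^sub>1(y) g\<^sub>2(x) \<le> g\<^sub>1(x) g\<^sub>2(y)\<close>.
\<close>

section \<open>Comparison of finite Borel measures\<close>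

text \<open>The pointwise sum of two measures. It is countably additive once both live on the same
  sigma-algebra, whence the assumption \<open>sets N = sets M\<close> in its evaluation. It serves
  both to complete a smaller measure to a larger one and as a common dominating measure.\<close>

definition sum_measure :: "'a measure \<Rightarrow> 'a measure \<Rightarrow> 'a measure" where
  "sum_measure M N = measure_of (space M) (sets M) (\<lambda>A. emeasure M A + emeasure N A)"

lemma space_sum_measure [simp]: "space (sum_measure M N) = space M"
  and sets_sum_measure [simp, measurable_cong]: "sets (sum_measure M N) = sets M"
  by (simp_all add: sum_measure_def)

lemma emeasure_sum_measure:
  assumes "sets N = sets M" and "A \<in> sets M"
  shows "emeasure (sum_measure M N) A = emeasure M A + emeasure N A"
proof (rule emeasure_measure_of[OF sum_measure_def])
  show "positive (sets (sum_measure M N)) (\<lambda>A. emeasure M A + emeasure N A)"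
    by (simp add: positive_def)
  show "countably_additive (sets (sum_measure M N)) (\<lambda>A. emeasure M A + emeasure N A)"
    by (rule countably_additiveI)
      (simp add: suminf_add[symmetric] suminf_emeasure assms(1))
qed (use assms sets.sets_into_space in auto)

lemma finite_borel_measure_sum_measure:
  assumes "finite_borel_measure M" and "finite_borel_measure N"
  shows "finite_borel_measure (sum_measure M N)"
proof -
  interpret M: finite_borel_measure M by fact
  interpret N: finite_borel_measure N by fact
  have "emeasure (sum_measure M N) (space (sum_measure M N)) \<noteq> \<infinity>"
    by (subst emeasure_sum_measure)
      (simp_all add: M.M_is_borel N.M_is_borel N.emeasure_finite flip: M.M_is_borel)
  then show ?thesis
    by (intro finite_borel_measure.intro finite_borel_measure_axioms.intro finite_measureI)
      (simp_all add: M.M_is_borel)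
qed

text \<open>The difference of the distribution functions is monotone and right-continuous, so it
  generates a measure \<open>L\<close>. Then \<open>M + L\<close> and \<open>N\<close> agree on
  half-open intervals, an intersection-stable generator, hence everywhere, and \<open>L\<close> is
  nonnegative.\<close>

lemma emeasure_le_if_Ioc_le:
  assumes M: "finite_borel_measure M" and N: "finite_borel_measure N"
    and le: "\<And>x y. x < y \<Longrightarrow> measure M {x<..y} \<le> measure N {x<..y}"
  shows "emeasure M A \<le> emeasure N A"
proof -
  interpret M: finite_borel_measure M by fact
  interpret N: finite_borel_measure N by fact
  define F where "F = (\<lambda>x. cdf N x - cdf M x)"
  define L where "L = interval_measure F"
  have mono: "F x \<le> F y" if "x \<le> y" for x y
    using that le[of x y] M.cdf_diff_eq[of x y] N.cdf_diff_eq[of x y]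
    by (cases "x = y") (auto simp: F_def)
  have cont: "continuous (at_right a) F" for a
    unfolding F_def by (intro continuous_diff M.cdf_is_right_cont N.cdf_is_right_cont)
  have sets_L: "sets L = sets M"
    by (simp add: L_def M.M_is_borel)
  have "sum_measure M L = N"
  proof (rule measure_eqI_generator_eq[where \<Omega> = UNIV])
    fix X assume "X \<in> range (\<lambda>(a, b). {a<..b::real})"
    then obtain a b where X: "X = {a<..b}" by auto
    have "emeasure M {a<..b} + emeasure L {a<..b} = emeasure N {a<..b}"
    proof (cases "a < b")
      case True
      then have "emeasure L {a<..b} = ennreal (F b - F a)"
        unfolding L_def by (intro emeasure_interval_measure_Ioc mono cont) auto
      moreover have "F b - F a = measure N {a<..b} - measure M {a<..b}"
        using True M.cdf_diff_eq[of a b] N.cdf_diff_eq[of a b] by (simp add: F_def)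
      ultimately show ?thesis
        using le[OF True]
        by (simp add: M.emeasure_eq_measure N.emeasure_eq_measure flip: ennreal_plus)
    qed simp
    then show "emeasure (sum_measure M L) X = emeasure N X"
      by (simp add: X emeasure_sum_measure sets_L M.M_is_borel)
  next
    show "emeasure (sum_measure M L) {- real i<..real i} \<noteq> \<infinity>" for i
      unfolding L_def
      by (subst emeasure_sum_measure)
        (auto simp: M.M_is_borel emeasure_interval_measure_Ioc[OF _ mono cont])
  next
    show "(\<Union>i. {- real i<..real i}) = UNIV"
      by (rule UN_Ioc_eq_UNIV)
  qed (auto simp: M.M_is_borel N.M_is_borel borel_sigma_sets_Ioc Int_stable_def)
  then show ?thesis
  proof (cases "A \<in> sets M")
    case True
    then have "emeasure N A = emeasure M A + emeasure L A"
      using \<open>sum_measure M L = N\<close> emeasure_sum_measure[OF sets_L True] by simp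
    then show ?thesis by simp
  \<comment> \<open>Outside the sigma-algebra \<open>emeasure\<close> has the default value
    0.\<close>
  qed (simp add: emeasure_notin_sets)
qed

section \<open>Almost everywhere inequalities between densities\<close>

text \<open>Test the measures on \<open>A = {g < f}\<close>: if \<open>A\<close> were not null, the
  integral of \<open>g\<close> over \<open>A\<close> would be strictly below that of
  \<open>f\<close>. The strictness rests on the integral of \<open>g\<close> being finite.\<close>

lemma AE_le_if_density_le:
  fixes f g :: "'a \<Rightarrow> ennreal"
  assumes [measurable]: "f \<in> borel_measurable M" "g \<in> borel_measurable M"
    and fin: "(\<integral>\<^sup>+x. g x \<partial>M) \<noteq> \<infinity>"
    and le: "\<And>A. A \<in> sets M \<Longrightarrow> emeasure (density M f) A \<le> emeasure (density M g) A"
  shows "AE x in M. f x \<le> g x"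
proof (rule ccontr)
  define A where "A = {x \<in> space M. g x < f x}"
  have [measurable]: "A \<in> sets M" by (simp add: A_def)
  assume "\<not> (AE x in M. f x \<le> g x)"
  then have neg: "\<not> (AE x in M. f x * indicator A x \<le> g x * indicator A x)"
    by (rule contrapos_nn, elim AE_mp) (auto simp: A_def indicator_def not_less)
  have "(\<integral>\<^sup>+x. g x * indicator A x \<partial>M) \<le> (\<integral>\<^sup>+x. g x \<partial>M)"
    by (intro nn_integral_mono) (simp add: indicator_def)
  then have "(\<integral>\<^sup>+x. g x * indicator A x \<partial>M) < (\<integral>\<^sup>+x. f x * indicator A x \<partial>M)"
    using fin neg
    by (intro nn_integral_less) (auto simp: A_def indicator_def top_unique less_imp_le)
  also have "\<dots> \<le> (\<integral>\<^sup>+x. g x * indicator A x \<partial>M)"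
    using le[of A] by (simp add: emeasure_density)
  finally show False by simp
qed

text \<open>Restricting to \<open>S\<close> and scaling by \<open>a\<close> and \<open>b\<close>
  gives finite measures comparable on intervals, hence on all Borel sets, hence through their
  densities. In the application \<open>S\<close> is one of the two half-lines at a threshold
  \<open>q\<close>.\<close>

lemma AE_density_le_if_Ioc_le:
  assumes M: "finite_borel_measure M" and N: "finite_borel_measure N"
    and f: "is_density M \<mu> f" and g: "is_density N \<mu> g"
    and [measurable]: "S \<in> sets borel" and nonneg: "0 \<le> a" "0 \<le> b"
    and le: "\<And>x y. x < y \<Longrightarrow> a * measure M ({x<..y} \<inter> S) \<le> b * measure N ({x<..y} \<inter> S)"
  shows "AE x in \<mu>. x \<in> S \<longrightarrow> a * f x \<le> b * g x"
proof -
  interpret M: finite_borel_measure M by fact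
  have sets_\<mu>: "sets \<mu> = sets borel"
    using f M.M_is_borel by (auto simp: is_density_def)
  \<comment> \<open>This is \<open>c\<close> times the restriction to \<open>S\<close> of the
    measure with density \<open>h\<close>.\<close>
  define weighted where
    "weighted c h = density \<mu> (\<lambda>x. ennreal (c * h x * indicator S x))" for c :: real and h
  have weighted_le:
    "finite_borel_measure (weighted c h)"
    "\<And>A. A \<in> sets borel \<Longrightarrow> measure (weighted c h) A = c * measure K (A \<inter> S)"
    if K: "finite_borel_measure K" and h: "is_density K \<mu> h" and c: "0 \<le> c" for K c h
  proof -
    interpret K: finite_borel_measure K by fact
    have [measurable]: "h \<in> borel_measurable \<mu>"
      using h sets_\<mu> by (simp add: is_density_def cong: measurable_cong_sets)
    have [measurable]: "S \<in> sets \<mu>" by (simp add: sets_\<mu>)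
    have em: "emeasure (weighted c h) A = ennreal (c * measure K (A \<inter> S))" if "A \<in> sets borel" for A
    proof -
      have [measurable]: "A \<in> sets \<mu>" using that by (simp add: sets_\<mu>)
      have "emeasure (weighted c h) A
          = (\<integral>\<^sup>+x. ennreal c * (ennreal (h x) * indicator (A \<inter> S) x) \<partial>\<mu>)"
        unfolding weighted_def
        by (subst emeasure_density)
          (auto intro!: nn_integral_cong simp: indicator_def ennreal_mult'[OF c])
      also have "\<dots> = ennreal c * emeasure (density \<mu> (\<lambda>x. ennreal (h x))) (A \<inter> S)"
        by (simp add: nn_integral_cmult emeasure_density)
      also have "density \<mu> (\<lambda>x. ennreal (h x)) = K"
        using h by (simp add: is_density_def)
      also have "ennreal c * emeasure K (A \<inter> S) = ennreal (c * measure K (A \<inter> S))"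
        by (simp add: K.emeasure_eq_measure ennreal_mult'[OF c])
      finally show ?thesis .
    qed
    have "space (weighted c h) = UNIV"
      using sets_eq_imp_space_eq[OF sets_\<mu>] by (simp add: weighted_def)
    then show "finite_borel_measure (weighted c h)"
      by (intro finite_borel_measure.intro finite_borel_measure_axioms.intro finite_measureI)
        (simp_all add: em, simp add: weighted_def sets_\<mu>)
    show "measure (weighted c h) A = c * measure K (A \<inter> S)" if "A \<in> sets borel" for A
      using em[OF that] c by (simp add: measure_def)
  qed
  have [measurable]: "f \<in> borel_measurable \<mu>" "g \<in> borel_measurable \<mu>" "S \<in> sets \<mu>"
    using f g sets_\<mu> by (simp_all add: is_density_def cong: measurable_cong_sets)
  have "AE x in \<mu>. ennreal (a * f x * indicator S x) \<le> ennreal (b * g x * indicator S x)"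
  proof (rule AE_le_if_density_le)
    fix A
    show "emeasure (density \<mu> (\<lambda>x. ennreal (a * f x * indicator S x))) A
        \<le> emeasure (density \<mu> (\<lambda>x. ennreal (b * g x * indicator S x))) A"
      using weighted_le[OF M f nonneg(1)] weighted_le[OF N g nonneg(2)] le
      by (fold weighted_def, intro emeasure_le_if_Ioc_le) auto
  next
    interpret W: finite_borel_measure "weighted b g"
      by (rule weighted_le[OF N g nonneg(2)])
    show "(\<integral>\<^sup>+x. ennreal (b * g x * indicator S x) \<partial>\<mu>) \<noteq> \<infinity>"
      using W.emeasure_finite[of "space \<mu>"]
      by (simp add: weighted_def emeasure_density cong: nn_integral_cong)
  qed simp_all
  then show ?thesis
    using g nonneg by (elim AE_mp) (auto simp: is_density_def)
qed

section \<open>Existence of densities\<close>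

text \<open>Radon-Nikodym with respect to \<open>M + N\<close>, which dominates both measures.
  Finiteness of \<open>M\<close> and \<open>N\<close> yields real-valued versions of the
  derivatives.\<close>

lemma ex_dominating_densities:
  assumes M: "finite_borel_measure M" and N: "finite_borel_measure N"
  obtains \<mu> f g where "sigma_finite_borel \<mu>" "is_density M \<mu> f" "is_density N \<mu> g"
proof -
  interpret M: finite_borel_measure M by fact
  interpret N: finite_borel_measure N by fact
  define \<mu> where "\<mu> = sum_measure M N"
  interpret \<mu>: finite_borel_measure \<mu>
    unfolding \<mu>_def by (rule finite_borel_measure_sum_measure[OF M N])
  have em: "emeasure \<mu> A = emeasure M A + emeasure N A" if "A \<in> sets borel" for A
    using that by (simp add: \<mu>_def emeasure_sum_measure M.M_is_borel N.M_is_borel)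
  have ex: "\<exists>h. is_density K \<mu> h"
    if K: "finite_borel_measure K" and le: "\<And>A. A \<in> sets borel \<Longrightarrow> emeasure K A \<le> emeasure \<mu> A" for K
  proof -
    interpret K: finite_borel_measure K by fact
    have ac: "absolutely_continuous \<mu> K"
      using le by (force simp: absolutely_continuous_def null_sets_def \<mu>.M_is_borel K.M_is_borel)
    have sets_K: "sets K = sets \<mu>" by (simp add: K.M_is_borel \<mu>.M_is_borel)
    obtain h where h: "h \<in> borel_measurable \<mu>" "AE x in \<mu>. RN_deriv \<mu> K x = ennreal (h x)"
      "\<And>x. 0 \<le> h x"
      using \<mu>.real_RN_deriv[OF K.finite_measure_axioms ac sets_K] by metis
    have "K = density \<mu> (RN_deriv \<mu> K)"
      using \<mu>.density_RN_deriv[OF ac sets_K] by simp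
    also have "\<dots> = density \<mu> (\<lambda>x. ennreal (h x))"
      using h by (intro density_cong) auto
    finally have "is_density K \<mu> h"
      using h \<mu>.M_is_borel by (simp add: is_density_def cong: measurable_cong_sets)
    then show ?thesis by blast
  qed
  have "sigma_finite_borel \<mu>"
    using \<mu>.M_is_borel \<mu>.sigma_finite_measure_axioms by (simp add: sigma_finite_borel_def)
  moreover from ex[OF M] ex[OF N] em obtain f g where "is_density M \<mu> f" "is_density N \<mu> g"
    by auto
  ultimately show ?thesis using that by blast
qed

section \<open>From intervals to densities\<close>

lemma ex_dense_seq_at_right:
  fixes x :: real
  assumes "closure D = UNIV"
  obtains X where "\<And>n. X n \<in> D" "filterlim X (at_right x) sequentially"
proof -
  have "\<exists>d\<in>D. x < d \<and> d < x + inverse (real (Suc n))" for n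
  proof -
    have "x + inverse (real (Suc n)) / 2 \<in> {x<..<x + inverse (real (Suc n))}"
      by (simp add: field_simps)
    then have "{x<..<x + inverse (real (Suc n))} \<inter> closure D \<noteq> {}"
      unfolding assms by blast
    then show ?thesis
      by (subst (asm) open_Int_closure_eq_empty) auto
  qed
  then obtain X where X: "\<And>n. X n \<in> D" "\<And>n. x < X n" "\<And>n. X n < x + inverse (real (Suc n))"
    by metis
  have "X \<longlonglongrightarrow> x"
  proof (rule real_tendsto_sandwich[of "\<lambda>_. x" X])
    show "(\<lambda>n. x + inverse (real (Suc n))) \<longlonglongrightarrow> x"
      using tendsto_add[OF tendsto_const LIMSEQ_inverse_real_of_nat, of x] by simp
  qed (use X in \<open>auto intro!: always_eventually less_imp_le\<close>)
  then have "filterlim X (at_right x) sequentially"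
    using X(2) by (auto simp: filterlim_at less_imp_neq[symmetric] intro!: always_eventually)
  with X(1) show ?thesis by (rule that)
qed

text \<open>Interval measures are differences of distribution functions, which are only
  right-continuous; so all three endpoints are approximated from the right by points of
  \<open>D\<close>.\<close>

lemma Ioc_cross_if_dense:
  assumes M: "finite_borel_measure M" and N: "finite_borel_measure N"
    and D: "closure D = UNIV"
    and le: "\<And>x y z. x \<in> D \<Longrightarrow> y \<in> D \<Longrightarrow> z \<in> D \<Longrightarrow> x < y \<Longrightarrow> y < z \<Longrightarrow>
      measure M {y<..z} * measure N {x<..y} \<le> measure M {x<..y} * measure N {y<..z}"
    and "x < y" "y < z"
  shows "measure M {y<..z} * measure N {x<..y} \<le> measure M {x<..y} * measure N {y<..z}"
proof -
  interpret M: finite_borel_measure M by fact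
  interpret N: finite_borel_measure N by fact
  obtain X where X: "\<And>n. X n \<in> D" "filterlim X (at_right x) sequentially"
    using ex_dense_seq_at_right[OF D] by blast
  obtain Y where Y: "\<And>n. Y n \<in> D" "filterlim Y (at_right y) sequentially"
    using ex_dense_seq_at_right[OF D] by blast
  obtain Z where Z: "\<And>n. Z n \<in> D" "filterlim Z (at_right z) sequentially"
    using ex_dense_seq_at_right[OF D] by blast
  have cont: "((\<lambda>n. cdf M (V n)) \<longlonglongrightarrow> cdf M v) \<and> ((\<lambda>n. cdf N (V n)) \<longlonglongrightarrow> cdf N v)"
    if "filterlim V (at_right v) sequentially" for V v
    using M.cdf_is_right_cont[of v] N.cdf_is_right_cont[of v] filterlim_compose[OF _ that]
    by (auto simp: continuous_within)
  \<comment> \<open>The next three facts put the approximating points in the order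
    \<open>X n < Y n < Z n\<close> for large \<open>n\<close>, so that the hypothesis on
    \<open>D\<close> applies.\<close>
  have "eventually (\<lambda>n. X n < y) sequentially"
    using X(2) \<open>x < y\<close> by (auto simp: filterlim_at intro: order_tendstoD)
  moreover have "eventually (\<lambda>n. y < Y n \<and> Y n < z) sequentially"
    using Y(2) \<open>y < z\<close>
    by (auto simp: filterlim_at elim: eventually_elim2 dest!: order_tendstoD(2)[of _ _ _ z])
  moreover have "eventually (\<lambda>n. z < Z n) sequentially"
    using Z(2) by (auto simp: filterlim_at elim: eventually_mono)
  ultimately have ev: "eventually (\<lambda>n.
      (cdf M (Z n) - cdf M (Y n)) * (cdf N (Y n) - cdf N (X n))
      \<le> (cdf M (Y n) - cdf M (X n)) * (cdf N (Z n) - cdf N (Y n))) sequentially"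
  proof eventually_elim
    case (elim n)
    then have "X n < Y n" "Y n < Z n" by auto
    then show ?case
      using le[OF X(1) Y(1) Z(1)] by (simp add: M.cdf_diff_eq N.cdf_diff_eq)
  qed
  have "(cdf M z - cdf M y) * (cdf N y - cdf N x) \<le> (cdf M y - cdf M x) * (cdf N z - cdf N y)"
  proof (rule tendsto_le[OF _ _ _ ev])
    show "(\<lambda>n. (cdf M (Y n) - cdf M (X n)) * (cdf N (Z n) - cdf N (Y n)))
        \<longlonglongrightarrow> (cdf M y - cdf M x) * (cdf N z - cdf N y)"
      using cont[OF X(2)] cont[OF Y(2)] cont[OF Z(2)] by (auto intro!: tendsto_intros)
    show "(\<lambda>n. (cdf M (Z n) - cdf M (Y n)) * (cdf N (Y n) - cdf N (X n)))
        \<longlonglongrightarrow> (cdf M z - cdf M y) * (cdf N y - cdf N x)"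
      using cont[OF X(2)] cont[OF Y(2)] cont[OF Z(2)] by (auto intro!: tendsto_intros)
  qed simp
  then show ?thesis
    using assms(5,6) by (simp add: M.cdf_diff_eq N.cdf_diff_eq)
qed

section \<open>Separating the intervals on the two sides of a threshold\<close>

text \<open>Compare both intervals with the gap \<open>?K\<close> between them: the two adjacent
  inequalities chain after cancelling \<open>measure M ?K\<close>. If that factor is 0, the interval
  \<open>?I\<close> enlarged by the gap is used instead, since this leaves its
  \<open>M\<close>-measure unchanged.\<close>

lemma Ioc_cross_disjoint:
  assumes M: "finite_borel_measure M" and N: "finite_borel_measure N"
    and le: "\<And>x y z. x < y \<Longrightarrow> y < z \<Longrightarrow>
      measure M {y<..z} * measure N {x<..y} \<le> measure M {x<..y} * measure N {y<..z}"
    and "a < b" "b \<le> c" "c < d"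
  shows "measure M {c<..d} * measure N {a<..b} \<le> measure M {a<..b} * measure N {c<..d}"
proof (cases "b = c")
  case True
  then show ?thesis using le assms(4-6) by simp
next
  case False
  interpret M: finite_borel_measure M by fact
  interpret N: finite_borel_measure N by fact
  have "b < c" using False assms(5) by simp
  let ?I = "{a<..b}" and ?K = "{b<..c}" and ?J = "{c<..d}"
  have IK: "measure M ?K * measure N ?I \<le> measure M ?I * measure N ?K"
    and KJ: "measure M ?J * measure N ?K \<le> measure M ?K * measure N ?J"
    using le assms(4,6) \<open>b < c\<close> by auto
  have "measure M {a<..c} = measure M ?I + measure M ?K"
    "measure N {a<..c} = measure N ?I + measure N ?K"
    using assms(4) \<open>b < c\<close> by (simp_all flip: M.cdf_diff_eq N.cdf_diff_eq)
  then have IKJ: "measure M ?J * (measure N ?I + measure N ?K)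
      \<le> (measure M ?I + measure M ?K) * measure N ?J"
    using le[of a c d] assms(4,6) \<open>b < c\<close> by simp
  show ?thesis
  proof (cases "measure M ?K = 0")
    case True
    have "measure M ?J * measure N ?I \<le> measure M ?J * (measure N ?I + measure N ?K)"
      by (intro mult_left_mono) auto
    with IKJ show ?thesis using True by simp
  next
    case False
    then have pos: "0 < measure M ?K" by (simp add: zero_less_measure_iff)
    have "measure M ?K * (measure M ?J * measure N ?I) \<le> measure M ?J * (measure M ?I * measure N ?K)"
      using mult_left_mono[OF IK, of "measure M ?J"] by (simp add: algebra_simps)
    also have "\<dots> \<le> measure M ?K * (measure M ?I * measure N ?J)"
      using mult_left_mono[OF KJ, of "measure M ?I"] by (simp add: algebra_simps)
    finally show ?thesis using pos by simp
  qed
qed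

text \<open>The share \<open>N / (M + N)\<close> of any interval left of \<open>q\<close> is at most
  that of any interval to its right, so the supremum \<open>s\<close> of the left shares separates
  them. Unlike \<open>N / M\<close>, the share stays in \<open>[0, 1]\<close> where \<open>M\<close>
  vanishes.\<close>

lemma ex_separating_slope:
  assumes M: "finite_borel_measure M" and N: "finite_borel_measure N"
    and le: "\<And>x y z. x < y \<Longrightarrow> y < z \<Longrightarrow>
      measure M {y<..z} * measure N {x<..y} \<le> measure M {x<..y} * measure N {y<..z}"
  obtains s where "0 \<le> s" "s \<le> 1"
    "\<And>a b. a < b \<Longrightarrow> b \<le> q \<Longrightarrow> (1 - s) * measure N {a<..b} \<le> s * measure M {a<..b}"
    "\<And>c d. q \<le> c \<Longrightarrow> c < d \<Longrightarrow> s * measure M {c<..d} \<le> (1 - s) * measure N {c<..d}"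
proof -
  define r where "r = (\<lambda>(a, b). measure N {a<..b} / (measure M {a<..b} + measure N {a<..b}))"
  define P where "P = {(a, b). a < b \<and> b \<le> q}"
  define s where "s = (SUP p\<in>P. r p)"
  have "(q - 1, q) \<in> P"
    by (simp add: P_def)
  then have "P \<noteq> {}" by blast
  have r01: "0 \<le> r p \<and> r p \<le> 1" for p
    by (auto simp: r_def divide_le_eq_1 add_nonneg_eq_0_iff order_less_le split: prod.split)
  have bdd: "bdd_above (r ` P)"
    using r01 by (intro bdd_aboveI2[where M = 1]) simp
  have r_le: "r p \<le> s" if "p \<in> P" for p
    unfolding s_def using that bdd by (rule cSUP_upper)
  have s0: "0 \<le> s"
    using \<open>P \<noteq> {}\<close> r_le r01 by (meson all_not_in_conv order_trans)
  have s1: "s \<le> 1"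
    unfolding s_def using \<open>P \<noteq> {}\<close> r01 by (intro cSUP_least) auto
  have left: "(1 - s) * measure N {a<..b} \<le> s * measure M {a<..b}" if "a < b" "b \<le> q" for a b
  proof (cases "measure M {a<..b} + measure N {a<..b} = 0")
    case True
    then show ?thesis by (simp add: add_nonneg_eq_0_iff)
  next
    case False
    then have "0 < measure M {a<..b} + measure N {a<..b}"
      by (metis add_nonneg_nonneg measure_nonneg order_le_less)
    then show ?thesis
      using r_le[of "(a, b)"] that by (simp add: P_def r_def field_simps)
  qed
  have right: "s * measure M {c<..d} \<le> (1 - s) * measure N {c<..d}" if "q \<le> c" "c < d" for c d
  proof (cases "measure M {c<..d} + measure N {c<..d} = 0")
    case True
    then show ?thesis by (simp add: add_nonneg_eq_0_iff)
  next
    case False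
    then have pos: "0 < measure M {c<..d} + measure N {c<..d}"
      by (metis add_nonneg_nonneg measure_nonneg order_le_less)
    have "s \<le> r (c, d)"
      unfolding s_def
    proof (rule cSUP_least[OF \<open>P \<noteq> {}\<close>])
      fix p assume "p \<in> P"
      then obtain a b where p: "p = (a, b)" "a < b" "b \<le> q" by (auto simp: P_def)
      show "r p \<le> r (c, d)"
      proof (cases "measure M {a<..b} + measure N {a<..b} = 0")
        \<comment> \<open>A left interval null for both measures has share \<open>0 / 0 = 0\<close>,
          which lies below every share.\<close>
        case True
        then show ?thesis using r01[of "(c, d)"] by (simp add: r_def p)
      next
        case False
        then have "0 < measure M {a<..b} + measure N {a<..b}"
          by (metis add_nonneg_nonneg measure_nonneg order_le_less)
        moreover have "measure M {c<..d} * measure N {a<..b} \<le> measure M {a<..b} * measure N {c<..d}"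
          using p that by (intro Ioc_cross_disjoint[OF M N le]) auto
        \<comment> \<open>After clearing denominators the product of the two
          \<open>N\<close>-measures cancels, leaving exactly the cross inequality.\<close>
        ultimately show ?thesis
          using pos by (simp add: r_def p frac_le_eq divide_le_0_iff algebra_simps)
      qed
    qed
    then show ?thesis
      using pos by (simp add: r_def field_simps)
  qed
  show ?thesis by (rule that[OF s0 s1 left right])
qed

section \<open>Pointwise cross inequality for suitable versions of the densities\<close>

lemma density_cross_ineq_if_Ioc_cross:
  assumes M: "finite_borel_measure M" and N: "finite_borel_measure N"
    and le: "\<And>x y z. x < y \<Longrightarrow> y < z \<Longrightarrow>
      measure M {y<..z} * measure N {x<..y} \<le> measure M {x<..y} * measure N {y<..z}"
  shows "density_cross_ineq M N"
proof -
  obtain \<mu> f g where \<mu>: "sigma_finite_borel \<mu>" and f: "is_density M \<mu> f" and g: "is_density N \<mu> g"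
    using ex_dominating_densities[OF M N] .
  \<comment> \<open>The point \<open>q\<close> itself belongs to the left side, matching the
    half-open intervals that end or begin at \<open>q\<close>.\<close>
  define separates where "separates q s x \<longleftrightarrow>
    (x \<le> q \<longrightarrow> (1 - s) * g x \<le> s * f x) \<and> (q < x \<longrightarrow> s * f x \<le> (1 - s) * g x)" for q s x
  have "\<exists>s. 0 \<le> s \<and> s \<le> 1 \<and> (AE x in \<mu>. separates q s x)" for q
  proof -
    obtain s where s: "0 \<le> s" "s \<le> 1"
      and left: "\<And>a b. a < b \<Longrightarrow> b \<le> q \<Longrightarrow> (1 - s) * measure N {a<..b} \<le> s * measure M {a<..b}"
      and right: "\<And>c d. q \<le> c \<Longrightarrow> c < d \<Longrightarrow> s * measure M {c<..d} \<le> (1 - s) * measure N {c<..d}"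
      using ex_separating_slope[OF M N le, where q = q] by blast
    have "AE x in \<mu>. x \<in> {..q} \<longrightarrow> (1 - s) * g x \<le> s * f x"
    proof (rule AE_density_le_if_Ioc_le[OF N M g f])
      fix x y :: real
      \<comment> \<open>Cutting at \<open>q\<close> leaves a half-open interval on the left of
        \<open>q\<close>, or the empty set, where the inequality is trivial.\<close>
      have "{x<..y} \<inter> {..q} = {x<..min y q}" by auto
      then show "(1 - s) * measure N ({x<..y} \<inter> {..q}) \<le> s * measure M ({x<..y} \<inter> {..q})"
        using left[of x "min y q"] by (cases "x < min y q") auto
    qed (use s in auto)
    moreover have "AE x in \<mu>. x \<in> {q<..} \<longrightarrow> s * f x \<le> (1 - s) * g x"
    proof (rule AE_density_le_if_Ioc_le[OF M N f g])
      fix x y :: real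
      have "{x<..y} \<inter> {q<..} = {max x q<..y}" by auto
      then show "s * measure M ({x<..y} \<inter> {q<..}) \<le> (1 - s) * measure N ({x<..y} \<inter> {q<..})"
        using right[of "max x q" y] by (cases "max x q < y") auto
    qed (use s in auto)
    ultimately have "AE x in \<mu>. separates q s x"
      by eventually_elim (auto simp: separates_def)
    with s show ?thesis by blast
  qed
  then obtain s where s: "\<And>q. 0 \<le> s q" "\<And>q. s q \<le> 1"
    and ae: "\<And>q. AE x in \<mu>. separates q (s q) x"
    by metis
  \<comment> \<open>Rational thresholds give only countably many exceptional sets, yet one of them
    lies between any two reals.\<close>
  have "AE x in \<mu>. \<forall>q\<in>\<rat>. separates q (s q) x"
    using ae by (simp add: AE_ball_countable countable_rat)
  then obtain E where E: "E \<in> null_sets \<mu>"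
    and sep: "\<And>x q. x \<in> space \<mu> - E \<Longrightarrow> q \<in> \<rat> \<Longrightarrow> separates q (s q) x"
    by (elim AE_E3) blast
  have sets_\<mu>: "sets \<mu> = sets borel" using \<mu> by (simp add: sigma_finite_borel_def)
  have [measurable]: "E \<in> sets borel" using E sets_\<mu> by auto
  have space_\<mu>: "space \<mu> = UNIV" using sets_eq_imp_space_eq[OF sets_\<mu>] by simp
  txt \<open>On the exceptional null set both densities can be set to \<open>0\<close>, which makes the
    cross inequality trivial there.\<close>
  have modify: "is_density K \<mu> (\<lambda>x. h x * indicator (- E) x)" if h: "is_density K \<mu> h" for K h
  proof -
    have h': "h \<in> borel_measurable borel" "\<And>x. 0 \<le> h x" "K = density \<mu> (\<lambda>x. ennreal (h x))"
      using h by (auto simp: is_density_def)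
    have [measurable]: "h \<in> borel_measurable \<mu>" "E \<in> sets \<mu>"
      using h'(1) E sets_\<mu> by (auto cong: measurable_cong_sets)
    have "density \<mu> (\<lambda>x. ennreal (h x)) = density \<mu> (\<lambda>x. ennreal (h x * indicator (- E) x))"
    proof (rule density_cong)
      show "AE x in \<mu>. ennreal (h x) = ennreal (h x * indicator (- E) x)"
        using AE_not_in[OF E] by eventually_elim simp
      have [measurable]: "- E \<in> sets \<mu>" by (simp add: sets_\<mu>)
      show "(\<lambda>x. ennreal (h x * indicator (- E) x)) \<in> borel_measurable \<mu>" by measurable
    qed measurable
    moreover have "(\<lambda>x. h x * indicator (- E) x) \<in> borel_measurable borel"
      using h'(1) by measurable
    ultimately show ?thesis
      using h'(2,3) by (simp add: is_density_def)
  qed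
  have "f y * indicator (- E) y * (g x * indicator (- E) x)
      \<le> f x * indicator (- E) x * (g y * indicator (- E) y)" if "x < y" for x y
  proof (cases "x \<in> E \<or> y \<in> E")
    case False
    obtain q where q: "q \<in> \<rat>" "x < q" "q < y"
      using Rats_dense_in_real \<open>x < y\<close> by blast
    have l: "(1 - s q) * g x \<le> s q * f x" and r: "s q * f y \<le> (1 - s q) * g y"
      using sep[of x q] sep[of y q] False q by (auto simp: space_\<mu> separates_def)
    have nonneg: "0 \<le> f x" "0 \<le> f y" "0 \<le> g x" "0 \<le> g y"
      using f g by (auto simp: is_density_def)
    have "f y * g x \<le> f x * g y"
    proof -
      \<comment> \<open>For \<open>s q = 0\<close> the inequality \<open>l\<close> forces
        \<open>g x = 0\<close>, and for \<open>s q = 1\<close> the inequality \<open>r\<close>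
        forces \<open>f y = 0\<close>; either way the left side vanishes. Otherwise the product of
        \<open>l\<close> and \<open>r\<close> has the positive common factor
        \<open>s q * (1 - s q)\<close>.\<close>
      consider "s q = 0" | "s q = 1" | "0 < s q" "s q < 1"
        using s[of q] by linarith
      then show ?thesis
      proof cases
        case 3
        have "((1 - s q) * g x) * (s q * f y) \<le> (s q * f x) * ((1 - s q) * g y)"
          using 3 nonneg by (intro mult_mono l r) auto
        then have "(s q * (1 - s q)) * (f y * g x) \<le> (s q * (1 - s q)) * (f x * g y)"
          by (simp only: ac_simps)
        then show ?thesis using 3 by simp
      qed (use l r nonneg in auto)
    qed
    then show ?thesis using False by simp
  qed auto
  then show ?thesis
    unfolding density_cross_ineq_def using \<mu> modify[OF f] modify[OF g] by blast
qed

section \<open>The equivalences\<close>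

text \<open>The same \<open>\<mu>\<close> and densities serve both conditions: cross-multiplication
  is a pointwise equivalence, and only zero denominators need care.\<close>

lemma isotonic_density_ratio_iff_density_cross_ineq:
  "isotonic_density_ratio M N \<longleftrightarrow> density_cross_ineq M N"
proof -
  have "mono_on {x. f x + g x > 0} (\<lambda>x. ennreal (g x) / ennreal (f x)) \<longleftrightarrow>
      (\<forall>x y. x < y \<longrightarrow> f y * g x \<le> f x * g y)" (is "?mono \<longleftrightarrow> ?cross")
    if nonneg: "\<And>x. 0 \<le> f x" "\<And>x. 0 \<le> g x" for f g :: "real \<Rightarrow> real"
  proof
    assume mono: ?mono
    show ?cross
    proof (intro allI impI)
      fix x y :: real assume "x < y"
      show "f y * g x \<le> f x * g y"
      proof (cases "f y = 0 \<or> g x = 0")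
        case True
        then show ?thesis using nonneg by auto
      next
        case False
        then have pos: "0 < f y" "0 < g x" using nonneg by (simp_all add: order_less_le)
        then have "ennreal (g x) / ennreal (f x) \<le> ennreal (g y) / ennreal (f y)"
          using mono_onD[OF mono, of x y] \<open>x < y\<close> nonneg
          by (simp add: add_nonneg_pos add_pos_nonneg)
        then have le: "ennreal (g x) / ennreal (f x) \<le> ennreal (g y / f y)"
          using pos nonneg by (simp add: ratio_pos)
        \<comment> \<open>With \<open>g x > 0\<close>, a zero of \<open>f\<close> at
          \<open>x\<close> would make the left ratio infinite, while the right one is
          finite.\<close>
        then have "f x \<noteq> 0"
          using ratio_zero[OF pos(2)] by (auto simp: top_unique)
        then have "0 < f x" using nonneg by (simp add: order_less_le)
        then show ?thesis
          using le pos nonneg by (simp add: ratio_pos field_simps)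
      qed
    qed
  next
    assume cross: ?cross
    show ?mono
    proof (rule mono_onI)
      fix x y assume xy: "x \<in> {x. f x + g x > 0}" "y \<in> {x. f x + g x > 0}" "x \<le> y"
      show "ennreal (g x) / ennreal (f x) \<le> ennreal (g y) / ennreal (f y)"
      proof (cases "x = y")
        case False
        then have le: "f y * g x \<le> f x * g y" using cross xy(3) by simp
        show ?thesis
        proof (cases "f y = 0")
          \<comment> \<open>Membership of \<open>y\<close> in the domain gives
            \<open>g y > 0\<close>, so the right ratio is infinite.\<close>
          case True
          then show ?thesis using ratio_zero[of "g y"] xy(2) by simp
        next
          case False
          then have "0 < f y" using nonneg by (simp add: order_less_le)
          \<comment> \<open>If \<open>f x = 0\<close>, the cross inequality with
            \<open>f y > 0\<close> forces \<open>g x = 0\<close>, which excludes \<open>x\<close>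
            from the domain.\<close>
          moreover from this have "f x \<noteq> 0"
            using le xy(1) by (auto simp: mult_le_0_iff)
          then have "0 < f x" using nonneg by (simp add: order_less_le)
          ultimately show ?thesis
            using le nonneg by (simp add: ratio_pos field_simps)
        qed
      qed simp
    qed
  qed
  then have "is_density M \<mu> f \<Longrightarrow> is_density N \<mu> g \<Longrightarrow>
      mono_on {x. f x + g x > 0} (\<lambda>x. ennreal (g x) / ennreal (f x)) \<longleftrightarrow>
      (\<forall>x y. x < y \<longrightarrow> f y * g x \<le> f x * g y)" for \<mu> f g
    by (simp add: is_density_def)
  then show ?thesis
    unfolding isotonic_density_ratio_def density_cross_ineq_def by (simp cong: conj_cong)
qed

section \<open>From densities back to sets, and the cycle of implications\<close>

text \<open>Integrate the pointwise inequality twice, over \<open>y\<close> in \<open>B\<close> for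
  fixed \<open>x\<close> in \<open>A\<close>, then over \<open>x\<close> in \<open>A\<close>.
  Iterated integrals of products factor, so constants are pulled out one variable at a time.\<close>

lemma borel_cross_ineq_if_density_cross_ineq:
  assumes M: "finite_borel_measure M" and N: "finite_borel_measure N"
    and "density_cross_ineq M N"
  shows "borel_cross_ineq M N"
  unfolding borel_cross_ineq_def
proof (intro ballI impI)
  fix A B :: "real set"
  assume A: "A \<in> sets borel" and B: "B \<in> sets borel" and AB: "\<forall>a\<in>A. \<forall>b\<in>B. a < b"
  interpret M: finite_borel_measure M by fact
  interpret N: finite_borel_measure N by fact
  obtain \<mu> f g where \<mu>: "sigma_finite_borel \<mu>" and f: "is_density M \<mu> f" and g: "is_density N \<mu> g"
    and cross: "\<And>x y. x < y \<Longrightarrow> f y * g x \<le> f x * g y"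
    using assms(3) unfolding density_cross_ineq_def by blast
  have sets_\<mu>: "sets \<mu> = sets borel" using \<mu> by (simp add: sigma_finite_borel_def)
  have [measurable]: "f \<in> borel_measurable \<mu>" "g \<in> borel_measurable \<mu>" "A \<in> sets \<mu>" "B \<in> sets \<mu>"
    using f g A B sets_\<mu> by (auto simp: is_density_def cong: measurable_cong_sets)
  have nonneg: "0 \<le> f x" "0 \<le> g x" for x
    using f g by (auto simp: is_density_def)
  have em: "emeasure M C = (\<integral>\<^sup>+x. ennreal (f x) * indicator C x \<partial>\<mu>)"
    "emeasure N C = (\<integral>\<^sup>+x. ennreal (g x) * indicator C x \<partial>\<mu>)" if [measurable]: "C \<in> sets \<mu>" for C
    using f g by (auto simp: is_density_def emeasure_density)
  have pointwise: "ennreal (g x) * emeasure M B \<le> ennreal (f x) * emeasure N B" if "x \<in> A" for x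
  proof -
    have "ennreal (g x) * emeasure M B = (\<integral>\<^sup>+y. ennreal (g x) * (ennreal (f y) * indicator B y) \<partial>\<mu>)"
      by (simp add: em nn_integral_cmult)
    also have "\<dots> \<le> (\<integral>\<^sup>+y. ennreal (f x) * (ennreal (g y) * indicator B y) \<partial>\<mu>)"
    proof (rule nn_integral_mono)
      fix y
      show "ennreal (g x) * (ennreal (f y) * indicator B y)
          \<le> ennreal (f x) * (ennreal (g y) * indicator B y)"
        using cross[of x y] AB that nonneg
        by (auto simp: indicator_def mult.commute simp flip: ennreal_mult intro!: ennreal_leI)
    qed
    also have "\<dots> = ennreal (f x) * emeasure N B"
      by (simp add: em nn_integral_cmult)
    finally show ?thesis .
  qed
  have "emeasure M B * emeasure N A
      = (\<integral>\<^sup>+x. (ennreal (g x) * emeasure M B) * indicator A x \<partial>\<mu>)"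
    by (simp add: em(2)[of A] ac_simps flip: nn_integral_cmult)
  also have "\<dots> \<le> (\<integral>\<^sup>+x. (ennreal (f x) * emeasure N B) * indicator A x \<partial>\<mu>)"
    using pointwise by (intro nn_integral_mono) (auto simp: indicator_def)
  also have "\<dots> = emeasure M A * emeasure N B"
    by (simp add: em(1)[of A] ac_simps flip: nn_integral_cmult)
  finally show "measure M B * measure N A \<le> measure M A * measure N B"
    by (simp add: M.emeasure_eq_measure N.emeasure_eq_measure flip: ennreal_mult)
qed

theorem theorem1:
  fixes Q\<^sub>1 Q\<^sub>2 :: "real measure"
  assumes "prob_space Q\<^sub>1" and "sets Q\<^sub>1 = sets borel"
    and "prob_space Q\<^sub>2" and "sets Q\<^sub>2 = sets borel"
  shows "(isotonic_density_ratio Q\<^sub>1 Q\<^sub>2 \<longleftrightarrow> density_cross_ineq Q\<^sub>1 Q\<^sub>2) \<and>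
         (density_cross_ineq Q\<^sub>1 Q\<^sub>2 \<longleftrightarrow> borel_cross_ineq Q\<^sub>1 Q\<^sub>2) \<and>
         (borel_cross_ineq Q\<^sub>1 Q\<^sub>2 \<longleftrightarrow> interval_cross_ineq Q\<^sub>1 Q\<^sub>2)"
proof -
  have Q: "finite_borel_measure Q\<^sub>1" "finite_borel_measure Q\<^sub>2"
    using assms prob_space.axioms(1)
    by (auto simp: finite_borel_measure_def finite_borel_measure_axioms_def)
  \<comment> \<open>The conditions on densities, Borel sets and intervals are linked in a cycle; the
    isotonic ratio is joined to it by its equivalence with the density condition.\<close>
  have "borel_cross_ineq Q\<^sub>1 Q\<^sub>2" if "density_cross_ineq Q\<^sub>1 Q\<^sub>2"
    using borel_cross_ineq_if_density_cross_ineq[OF Q that] .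
  moreover have "interval_cross_ineq Q\<^sub>1 Q\<^sub>2" if "borel_cross_ineq Q\<^sub>1 Q\<^sub>2"
    using that unfolding borel_cross_ineq_def interval_cross_ineq_def
    by (intro exI[of _ UNIV]) auto
  moreover have "density_cross_ineq Q\<^sub>1 Q\<^sub>2" if "interval_cross_ineq Q\<^sub>1 Q\<^sub>2"
  proof -
    from that obtain D where D: "closure D = UNIV"
      and le: "\<And>x y z. x \<in> D \<Longrightarrow> y \<in> D \<Longrightarrow> z \<in> D \<Longrightarrow> x < y \<Longrightarrow> y < z \<Longrightarrow>
        measure Q\<^sub>1 {y<..z} * measure Q\<^sub>2 {x<..y} \<le> measure Q\<^sub>1 {x<..y} * measure Q\<^sub>2 {y<..z}"
      unfolding interval_cross_ineq_def by blast
    show ?thesis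
      by (rule density_cross_ineq_if_Ioc_cross[OF Q Ioc_cross_if_dense[OF Q D le]])
  qed
  ultimately show ?thesis
    using isotonic_density_ratio_iff_density_cross_ineq by blast
qed

end
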